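(* Let $\Lambda=\{\lambda_k\}_{k\ge 0}$ be a non-decreasing sequence of positive numbers tending to $\infty$ and let $r\ge 2$ be an integer. Then the complex linear space $c^r(\Lambda)$ of all $\Lambda^r$-strongly convergent sequences of complex numbers, endowed with the norm $$\|S\|_{c^r(\Lambda)}=\sup_{n\ge 0}\frac1{\lambda_n}\sum_{k=0}^n|\lambda_k s_k-\lambda_{k-r}s_{k-r}|\qquad (S=\{s_k\}_{k\ge0}),$$ is a Banach space.
   Context: Convention: for any sequences $\{\lambda_k\}_{k\ge0}$, $\{s_k\}_{k\ge0}$ put $\lambda_{-1}=\dots=\lambda_{-r}=0$ and $s_{-1}=\dots=s_{-r}=0$. A sequence $S=\{s_k\}_{k\ge 0}$ of complex numbers converges $\Lambda^r$-strongly to $s\in\mathbb C$ if $$\lim_{n\to\infty}\frac1{\lambda_n}\sum_{k=0}^n|\lambda_k(s_k-s)-\lambda_{k-r}(s_{k-r}-s)|=0.$$ $S$ is $\Lambda^r$-strongly convergent if this holds for some $s\in\mathbb C$. *)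

theory Defs
  imports "HOL-Analysis.Analysis" "HOL-Library.Function_Algebras"
begin

text \<open>Normed and Banach spaces over the complex numbers, carried by a linear subspace \<open>V\<close> of an
  ambient complex vector space. The function \<open>N\<close> is total, but only its values on \<open>V\<close> matter.\<close>

locale complex_normed_space_on = vector_space scale
  for scale :: "complex \<Rightarrow> 'a::ab_group_add \<Rightarrow> 'a" +
  fixes V :: "'a set" and N :: "'a \<Rightarrow> real"
  assumes subspace_carrier: "subspace V"
    and N_nonneg: "x \<in> V \<Longrightarrow> 0 \<le> N x"
    and N_eq_0_iff: "x \<in> V \<Longrightarrow> N x = 0 \<longleftrightarrow> x = 0"
    and N_scale: "x \<in> V \<Longrightarrow> N (scale c x) = cmod c * N x"
    and N_triangle: "x \<in> V \<Longrightarrow> y \<in> V \<Longrightarrow> N (x + y) \<le> N x + N y"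

locale complex_banach_space_on = complex_normed_space_on +
  assumes complete_carrier:
    "\<lbrakk>\<And>n::nat. X n \<in> V;
      \<And>e. e > 0 \<Longrightarrow> \<exists>M. \<forall>m\<ge>M. \<forall>n\<ge>M. N (X m - X n) < e\<rbrakk>
     \<Longrightarrow> \<exists>x\<in>V. (\<lambda>n. N (X n - x)) \<longlonglongrightarrow> 0"

text \<open>The delayed sequence \<open>a (k - r)\<close>, with the convention that terms of negative index are \<open>0\<close>
  (subtraction on \<^typ>\<open>nat\<close> would instead repeat \<open>a 0\<close>).\<close>

definition delay :: "nat \<Rightarrow> (nat \<Rightarrow> 'a::zero) \<Rightarrow> nat \<Rightarrow> 'a" where
  "delay r a k = (if r \<le> k then a (k - r) else 0)"

definition strongly_converges ::
  "(nat \<Rightarrow> real) \<Rightarrow> nat \<Rightarrow> (nat \<Rightarrow> complex) \<Rightarrow> complex \<Rightarrow> bool" where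
  "strongly_converges \<Lambda> r S s \<longleftrightarrow>
     (\<lambda>n. 1 / \<Lambda> n * (\<Sum>k=0..n. cmod (complex_of_real (\<Lambda> k) * (S k - s)
                       - complex_of_real (delay r \<Lambda> k) * (delay r S k - s)))) \<longlonglongrightarrow> 0"

definition c_space :: "(nat \<Rightarrow> real) \<Rightarrow> nat \<Rightarrow> (nat \<Rightarrow> complex) set" where
  "c_space \<Lambda> r = {S. \<exists>s. strongly_converges \<Lambda> r S s}"

definition c_mean :: "(nat \<Rightarrow> real) \<Rightarrow> nat \<Rightarrow> (nat \<Rightarrow> complex) \<Rightarrow> nat \<Rightarrow> real" where
  "c_mean \<Lambda> r S n =
     1 / \<Lambda> n * (\<Sum>k=0..n. cmod (complex_of_real (\<Lambda> k) * S k
                  - complex_of_real (delay r \<Lambda> k) * delay r S k))"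

text \<open>A real supremum, hence meaningful only where the means are bounded above.\<close>

definition c_norm :: "(nat \<Rightarrow> real) \<Rightarrow> nat \<Rightarrow> (nat \<Rightarrow> complex) \<Rightarrow> real" where
  "c_norm \<Lambda> r S = (SUP n. c_mean \<Lambda> r S n)"

end

(* Write D S k = Lambda_k S_k - Lambda_{k-r} S_{k-r}, so that the n-th mean is the seminorm
   (1 / Lambda_n) sum_{k<=n} |D S k| and S converges strongly to s iff the means of S - s tend to 0.
   Summing D along the residue class of n modulo r gives |S_n| <= n-th mean of S; hence norm-Cauchy
   implies pointwise Cauchy, and the strong limit, being an ordinary limit, is bounded by the norm.
   The means of the constant sequence 1 are at most r by telescoping.  For a Cauchy sequence X_m with
   strong limits s_m, the pointwise limit x and s = lim s_m then satisfy
   mean_n (x - s) <= mean_n (x - X_m) + mean_n (X_m - s_m) + r |s_m - s|. *)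

theory Submission
  imports Defs
begin

section \<open>Sums of delayed differences\<close>

lemma norm_le_sum_delay_differences:
  fixes a :: "nat \<Rightarrow> 'a::real_normed_vector"
  assumes "0 < r"
  shows "norm (a n) \<le> (\<Sum>k=0..n. norm (a k - delay r a k))"
\<comment> \<open>The induction steps back from n to n - r: the summand at n pays for passing from
  \<open>a (n - r)\<close> to \<open>a n\<close>, and below r the delayed term is 0, so the summand
  is \<open>norm (a n)\<close> itself.\<close>
proof (induction n rule: less_induct)
  case (less n)
  have split: "(\<Sum>k=0..n. norm (a k - delay r a k)) =
      norm (a n - delay r a n) + (\<Sum>k=0..<n. norm (a k - delay r a k))"
    by (simp flip: atLeastLessThanSuc_atLeastAtMost)
  show ?case
  proof (cases "r \<le> n")
    case True
    have "norm (a (n - r)) \<le> (\<Sum>k=0..n - r. norm (a k - delay r a k))"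
      using True assms by (intro less) auto
    \<comment> \<open>Since r is positive, {0..n - r} lies in {0..<n}, so the summand at n is still
      available.\<close>
    also have "\<dots> \<le> (\<Sum>k=0..<n. norm (a k - delay r a k))"
      using True assms by (intro sum_mono2) auto
    finally show ?thesis
      using split True norm_triangle_sub[of "a n" "a (n - r)"] by (simp add: delay_def)
  next
    case False
    then show ?thesis using split by (simp add: delay_def sum_nonneg)
  qed
qed

text \<open>An r-step difference is the sum over j < r of the one-step differences
  \<open>delay j a k - delay (Suc j) a k\<close>, and each of these telescopes to its last value
  \<open>delay j a n\<close>.\<close>

lemma sum_diff_delay:
  fixes a :: "nat \<Rightarrow> 'a::ab_group_add"
  shows "(\<Sum>k=0..n. a k - delay r a k) = (\<Sum>j<r. delay j a n)"
proof (induction r)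
  case 0
  then show ?case by (simp add: delay_def)
next
  case (Suc r)
  have step: "(\<Sum>k=0..n. delay r a k - delay (Suc r) a k) = delay r a n"
    by (induction n) (auto simp: delay_def)
  have "(\<Sum>k=0..n. a k - delay (Suc r) a k) =
      (\<Sum>k=0..n. a k - delay r a k) + (\<Sum>k=0..n. delay r a k - delay (Suc r) a k)"
    by (simp flip: sum.distrib)
  then show ?case using Suc step by simp
qed

lemma vector_space_pointwise_scale:
  "vector_space (\<lambda>(c::'a::field) (S::'b \<Rightarrow> 'a) k. c * S k)"
  by unfold_locales (auto simp: fun_eq_iff algebra_simps)

section \<open>The means as seminorms\<close>

locale strong_convergence_weights =
  fixes \<Lambda> :: "nat \<Rightarrow> real" and r :: nat
  assumes weight_pos: "0 < \<Lambda> k"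
    and weight_mono: "mono \<Lambda>"
    and delay_pos: "0 < r"
begin

lemma c_mean_nonneg: "0 \<le> c_mean \<Lambda> r S n"
  unfolding c_mean_def using weight_pos[of n] by (simp add: sum_nonneg)

lemma c_mean_scale: "c_mean \<Lambda> r (\<lambda>k. c * S k) n = cmod c * c_mean \<Lambda> r S n"
proof -
  have "cmod (complex_of_real (\<Lambda> k) * (c * S k)
        - complex_of_real (delay r \<Lambda> k) * delay r (\<lambda>k. c * S k) k) =
      cmod c * cmod (complex_of_real (\<Lambda> k) * S k
        - complex_of_real (delay r \<Lambda> k) * delay r S k)" for k
    by (auto simp: delay_def algebra_simps simp flip: norm_mult)
  then show ?thesis by (simp add: c_mean_def sum_distrib_left)
qed

lemma c_mean_add_le:
  "c_mean \<Lambda> r (\<lambda>k. S k + T k) n \<le> c_mean \<Lambda> r S n + c_mean \<Lambda> r T n"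
proof -
  let ?D = "\<lambda>S k. complex_of_real (\<Lambda> k) * S k - complex_of_real (delay r \<Lambda> k) * delay r S k"
  have "?D (\<lambda>k. S k + T k) k = ?D S k + ?D T k" for k
    by (auto simp: delay_def algebra_simps)
  then have "(\<Sum>k=0..n. cmod (?D (\<lambda>k. S k + T k) k)) \<le> (\<Sum>k=0..n. cmod (?D S k) + cmod (?D T k))"
    by (intro sum_mono) (simp add: norm_triangle_ineq)
  then show ?thesis
    unfolding c_mean_def using weight_pos[of n]
    by (simp add: sum.distrib divide_right_mono flip: add_divide_distrib)
qed

lemma c_mean_diff_commute:
  "c_mean \<Lambda> r (\<lambda>k. S k - T k) n = c_mean \<Lambda> r (\<lambda>k. T k - S k) n"
  using c_mean_scale[of "-1" "\<lambda>k. S k - T k" n] by simp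

text \<open>Monotone positive weights make all differences
  \<open>\<Lambda> k - delay r \<Lambda> k\<close> nonnegative, so the absolute values disappear and
  the sum collapses to r delayed weights, each at most \<open>\<Lambda> n\<close>. This controls the
  effect of changing the strong limit.\<close>

lemma c_mean_const_le: "c_mean \<Lambda> r (\<lambda>k. c) n \<le> cmod c * real r"
proof -
  have le: "delay j \<Lambda> k \<le> \<Lambda> k" for j k
    using weight_pos[of k] weight_mono by (auto simp: delay_def mono_def)
  have "cmod (complex_of_real (\<Lambda> k) - complex_of_real (delay r \<Lambda> k) * delay r (\<lambda>k. 1) k) =
      \<Lambda> k - delay r \<Lambda> k" for k
  proof -
    have "complex_of_real (\<Lambda> k) - complex_of_real (delay r \<Lambda> k) * delay r (\<lambda>k. 1) k =
        complex_of_real (\<Lambda> k - delay r \<Lambda> k)"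
      by (simp add: delay_def)
    then show ?thesis using le[of r k] by (simp only: norm_of_real)
  qed
  then have "c_mean \<Lambda> r (\<lambda>k. 1) n = (\<Sum>j<r. delay j \<Lambda> n) / \<Lambda> n"
    by (simp add: c_mean_def sum_diff_delay)
  also have "\<dots> \<le> real r"
    using weight_pos[of n] sum_bounded_above[of "{..<r}" "\<lambda>j. delay j \<Lambda> n" "\<Lambda> n"] le
    by (simp add: divide_le_eq)
  finally show ?thesis
    using c_mean_scale[of c "\<lambda>k. 1" n] by (simp add: mult_left_mono)
qed

text \<open>Apply \<open>norm_le_sum_delay_differences\<close> to the weighted sequence
  \<open>\<Lambda> k * S k\<close> and cancel the positive factor \<open>\<Lambda> n\<close>.
  Definiteness of the norm and all pointwise convergence rest on this bound.\<close>

lemma norm_le_c_mean: "cmod (S n) \<le> c_mean \<Lambda> r S n"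
proof -
  have "delay r (\<lambda>k. complex_of_real (\<Lambda> k) * S k) k =
      complex_of_real (delay r \<Lambda> k) * delay r S k" for k
    by (simp add: delay_def)
  then have "cmod (complex_of_real (\<Lambda> n) * S n) \<le> \<Lambda> n * c_mean \<Lambda> r S n"
    using norm_le_sum_delay_differences[OF delay_pos, of "\<lambda>k. complex_of_real (\<Lambda> k) * S k" n]
      weight_pos[of n]
    by (simp add: c_mean_def)
  then show ?thesis
    using weight_pos[of n] by (simp add: norm_mult)
qed

lemma c_mean_zero [simp]: "c_mean \<Lambda> r (\<lambda>k. 0) = (\<lambda>n. 0)"
  using c_mean_scale[of 0 "\<lambda>k. 0"] by (simp add: fun_eq_iff)

section \<open>Strong convergence\<close>

lemma strongly_converges_iff:
  "strongly_converges \<Lambda> r S s \<longleftrightarrow> (\<lambda>n. c_mean \<Lambda> r (\<lambda>k. S k - s) n) \<longlonglongrightarrow> 0"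
proof -
  \<comment> \<open>For k < r the left factor \<open>delay r S k - s\<close> is -s while the delay
    of S - s is 0; the vanishing weight \<open>delay r \<Lambda> k\<close> hides the
    discrepancy.\<close>
  have "complex_of_real (delay r \<Lambda> k) * (delay r S k - s) =
      complex_of_real (delay r \<Lambda> k) * delay r (\<lambda>k. S k - s) k" for k
    by (simp add: delay_def)
  then show ?thesis
    by (simp only: strongly_converges_def c_mean_def)
qed

lemma strongly_converges_imp_tendsto:
  assumes "strongly_converges \<Lambda> r S s"
  shows "S \<longlonglongrightarrow> s"
proof (rule Lim_null[THEN iffD2], rule Lim_null_comparison)
  show "\<forall>\<^sub>F n in sequentially. norm (S n - s) \<le> c_mean \<Lambda> r (\<lambda>k. S k - s) n"
    using norm_le_c_mean[of "\<lambda>k. S k - s"] by simp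
  show "(\<lambda>n. c_mean \<Lambda> r (\<lambda>k. S k - s) n) \<longlonglongrightarrow> 0"
    using assms by (simp add: strongly_converges_iff)
qed

lemma strongly_converges_add:
  assumes "strongly_converges \<Lambda> r S s" "strongly_converges \<Lambda> r T t"
  shows "strongly_converges \<Lambda> r (\<lambda>k. S k + T k) (s + t)"
  unfolding strongly_converges_iff
proof (rule Lim_null_comparison)
  show "\<forall>\<^sub>F n in sequentially. norm (c_mean \<Lambda> r (\<lambda>k. S k + T k - (s + t)) n) \<le>
      c_mean \<Lambda> r (\<lambda>k. S k - s) n + c_mean \<Lambda> r (\<lambda>k. T k - t) n"
    using c_mean_add_le[of "\<lambda>k. S k - s" "\<lambda>k. T k - t"]
    by (simp add: c_mean_nonneg algebra_simps)
  show "(\<lambda>n. c_mean \<Lambda> r (\<lambda>k. S k - s) n + c_mean \<Lambda> r (\<lambda>k. T k - t) n) \<longlonglongrightarrow> 0"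
    using assms unfolding strongly_converges_iff by (rule tendsto_add_zero)
qed

lemma strongly_converges_scale:
  assumes "strongly_converges \<Lambda> r S s"
  shows "strongly_converges \<Lambda> r (\<lambda>k. c * S k) (c * s)"
  using tendsto_mult_right_zero[OF assms[unfolded strongly_converges_iff], of "cmod c"]
  by (simp add: strongly_converges_iff right_diff_distrib flip: c_mean_scale)

section \<open>The sequence space and its norm\<close>

lemma zero_in_c_space: "0 \<in> c_space \<Lambda> r"
  by (auto simp: c_space_def strongly_converges_iff intro!: exI[of _ 0])

lemma add_in_c_space: "S \<in> c_space \<Lambda> r \<Longrightarrow> T \<in> c_space \<Lambda> r \<Longrightarrow> S + T \<in> c_space \<Lambda> r"
  unfolding c_space_def plus_fun_def by (blast intro: strongly_converges_add)

lemma scale_in_c_space: "S \<in> c_space \<Lambda> r \<Longrightarrow> (\<lambda>k. c * S k) \<in> c_space \<Lambda> r"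
  unfolding c_space_def by (blast intro: strongly_converges_scale)

lemma diff_in_c_space: "S \<in> c_space \<Lambda> r \<Longrightarrow> T \<in> c_space \<Lambda> r \<Longrightarrow> S - T \<in> c_space \<Lambda> r"
  using add_in_c_space[of S "\<lambda>k. -1 * T k"] scale_in_c_space[of T "-1"]
  by (simp add: plus_fun_def fun_diff_def)

text \<open>Split S into S - s, whose means converge and hence are bounded, and the constant s. This
  makes the supremum in \<open>c_norm\<close> an actual upper bound of the means.\<close>

lemma bdd_above_c_mean:
  assumes "S \<in> c_space \<Lambda> r"
  shows "bdd_above (range (c_mean \<Lambda> r S))"
proof -
  obtain s where s: "(\<lambda>n. c_mean \<Lambda> r (\<lambda>k. S k - s) n) \<longlonglongrightarrow> 0"
    using assms by (auto simp: c_space_def strongly_converges_iff)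
  then have "Bseq (\<lambda>n. c_mean \<Lambda> r (\<lambda>k. S k - s) n)"
    by (intro convergent_imp_Bseq convergentI)
  then obtain B where B: "\<And>n. c_mean \<Lambda> r (\<lambda>k. S k - s) n \<le> B"
    by (auto simp: Bseq_def c_mean_nonneg)
  have "c_mean \<Lambda> r S n \<le> B + cmod s * real r" for n
    using c_mean_add_le[of "\<lambda>k. S k - s" "\<lambda>k. s" n] B[of n] c_mean_const_le[of s n] by simp
  then show ?thesis by (auto intro: bdd_aboveI[of _ "B + cmod s * real r"])
qed

lemma c_mean_le_c_norm: "S \<in> c_space \<Lambda> r \<Longrightarrow> c_mean \<Lambda> r S n \<le> c_norm \<Lambda> r S"
  unfolding c_norm_def by (intro cSUP_upper bdd_above_c_mean) auto

lemma c_norm_le: "(\<And>n. c_mean \<Lambda> r S n \<le> b) \<Longrightarrow> c_norm \<Lambda> r S \<le> b"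
  unfolding c_norm_def by (intro cSUP_least) auto

lemma norm_le_c_norm: "S \<in> c_space \<Lambda> r \<Longrightarrow> cmod (S n) \<le> c_norm \<Lambda> r S"
  using norm_le_c_mean c_mean_le_c_norm order_trans by blast

lemma c_norm_nonneg: "S \<in> c_space \<Lambda> r \<Longrightarrow> 0 \<le> c_norm \<Lambda> r S"
  using c_mean_nonneg c_mean_le_c_norm order_trans by blast

lemma c_norm_eq_0_iff:
  assumes "S \<in> c_space \<Lambda> r"
  shows "c_norm \<Lambda> r S = 0 \<longleftrightarrow> S = 0"
proof
  assume "c_norm \<Lambda> r S = 0"
  then show "S = 0"
    using norm_le_c_norm[OF assms] by (auto simp: fun_eq_iff)
qed (simp add: c_norm_def zero_fun_def)

lemma c_norm_triangle:
  assumes "S \<in> c_space \<Lambda> r" "T \<in> c_space \<Lambda> r"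
  shows "c_norm \<Lambda> r (S + T) \<le> c_norm \<Lambda> r S + c_norm \<Lambda> r T"
  unfolding plus_fun_def
  using c_mean_add_le c_mean_le_c_norm[OF assms(1)] c_mean_le_c_norm[OF assms(2)]
  by (intro c_norm_le) (meson add_mono order_trans)

lemma c_norm_scale_le:
  assumes "S \<in> c_space \<Lambda> r"
  shows "c_norm \<Lambda> r (\<lambda>k. c * S k) \<le> cmod c * c_norm \<Lambda> r S"
  using c_mean_le_c_norm[OF assms] by (intro c_norm_le) (simp add: c_mean_scale mult_left_mono)

lemma c_norm_scale:
  assumes "S \<in> c_space \<Lambda> r"
  shows "c_norm \<Lambda> r (\<lambda>k. c * S k) = cmod c * c_norm \<Lambda> r S"
proof (cases "c = 0")
  case True
  then show ?thesis by (simp add: c_norm_def)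
next
  case False
  \<comment> \<open>The reverse inequality is the one-sided bound applied to the scaled sequence
    with factor 1/c.\<close>
  have "c_norm \<Lambda> r S \<le> cmod (inverse c) * c_norm \<Lambda> r (\<lambda>k. c * S k)"
    using c_norm_scale_le[OF scale_in_c_space[OF assms], of "inverse c" c] False
    by (simp flip: mult.assoc)
  then have "cmod c * c_norm \<Lambda> r S \<le> c_norm \<Lambda> r (\<lambda>k. c * S k)"
    using False by (simp add: norm_divide field_simps)
  with c_norm_scale_le[OF assms, of c] show ?thesis by simp
qed

section \<open>Completeness\<close>

lemma tendsto_c_mean:
  assumes "\<And>k. (\<lambda>l. S l k) \<longlonglongrightarrow> T k"
  shows "(\<lambda>l. c_mean \<Lambda> r (S l) n) \<longlonglongrightarrow> c_mean \<Lambda> r T n"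
proof -
  have "(\<lambda>l. delay r (S l) k) \<longlonglongrightarrow> delay r T k" for k
    using assms by (simp add: delay_def)
  then show ?thesis
    \<comment> \<open>For fixed n the mean is a finite sum, continuous in finitely many
      coordinates.\<close>
    unfolding c_mean_def by (intro tendsto_intros assms)
qed

lemma c_space_complete:
  assumes X: "\<And>n::nat. X n \<in> c_space \<Lambda> r"
    and Cauchy: "\<And>e. e > 0 \<Longrightarrow> \<exists>M. \<forall>m\<ge>M. \<forall>n\<ge>M. c_norm \<Lambda> r (X m - X n) < e"
  shows "\<exists>x\<in>c_space \<Lambda> r. (\<lambda>n. c_norm \<Lambda> r (X n - x)) \<longlonglongrightarrow> 0"
proof -
  \<comment> \<open>Applied twice: to each coordinate of X and to the sequence of strong
    limits.\<close>
  have Cauchy_if_le: "convergent f" if "\<And>m n. cmod (f m - f n) \<le> c_norm \<Lambda> r (X m - X n)"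
    for f :: "nat \<Rightarrow> complex"
    unfolding Cauchy_convergent_iff[symmetric] Cauchy_iff
    using Cauchy that by (meson order_le_less_trans)
  have diff: "X m - X n \<in> c_space \<Lambda> r" for m n
    by (intro diff_in_c_space X)
  have "convergent (\<lambda>n. X n k)" for k
    using norm_le_c_norm[OF diff] by (intro Cauchy_if_le) (simp add: fun_diff_def)
  then obtain x where x: "\<And>k. (\<lambda>n. X n k) \<longlonglongrightarrow> x k"
    unfolding convergent_def by metis
  obtain s where s: "\<And>m. strongly_converges \<Lambda> r (X m) (s m)"
    using X unfolding c_space_def by (simp add: mem_Collect_eq) metis
  have "cmod (s m - s n) \<le> c_norm \<Lambda> r (X m - X n)" for m n
  \<comment> \<open>Strong limits are ordinary limits, so the coordinatewise bound by the norm
    survives k tending to infinity.\<close>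
  proof (rule tendsto_upperbound)
    show "(\<lambda>k. cmod (X m k - X n k)) \<longlonglongrightarrow> cmod (s m - s n)"
      by (intro tendsto_intros strongly_converges_imp_tendsto s)
    show "\<forall>\<^sub>F k in sequentially. cmod (X m k - X n k) \<le> c_norm \<Lambda> r (X m - X n)"
      using norm_le_c_norm[OF diff, of m n] by (simp add: fun_diff_def)
  qed simp
  then obtain t where t: "s \<longlonglongrightarrow> t"
    using Cauchy_if_le unfolding convergent_def by blast
  \<comment> \<open>Let l tend to infinity in the means of X m - X l. The threshold M does not
    depend on n, so the bound later passes to the supremum.\<close>
  have mean_le: "\<exists>M. \<forall>m\<ge>M. \<forall>n. c_mean \<Lambda> r (\<lambda>k. X m k - x k) n \<le> e" if e: "e > 0" for e
  proof -
    obtain M where M: "\<And>m n. m \<ge> M \<Longrightarrow> n \<ge> M \<Longrightarrow> c_norm \<Lambda> r (X m - X n) < e"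
      using Cauchy[OF e] by blast
    have "c_mean \<Lambda> r (\<lambda>k. X m k - x k) n \<le> e" if m: "m \<ge> M" for m n
    proof (rule tendsto_upperbound)
      show "(\<lambda>l. c_mean \<Lambda> r (\<lambda>k. X m k - X l k) n) \<longlonglongrightarrow> c_mean \<Lambda> r (\<lambda>k. X m k - x k) n"
        by (intro tendsto_c_mean tendsto_intros x)
      have "c_mean \<Lambda> r (\<lambda>k. X m k - X l k) n \<le> e" if "l \<ge> M" for l
        using c_mean_le_c_norm[OF diff, of m l n] M[OF m that] by (simp add: fun_diff_def)
      then show "\<forall>\<^sub>F l in sequentially. c_mean \<Lambda> r (\<lambda>k. X m k - X l k) n \<le> e"
        unfolding eventually_sequentially by blast
    qed simp
    then show ?thesis by blast
  qed
  have "strongly_converges \<Lambda> r x t"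
    unfolding strongly_converges_iff
  proof (rule LIMSEQ_I)
    fix e :: real
    assume e: "0 < e"
    obtain M where M: "\<And>m n. m \<ge> M \<Longrightarrow> c_mean \<Lambda> r (\<lambda>k. X m k - x k) n \<le> e / 4"
      using mean_le[of "e / 4"] e by auto
    \<comment> \<open>The divisor r offsets the factor r in \<open>c_mean_const_le\<close>; the
      three contributions then total at most 3e/4.\<close>
    have "0 < e / (4 * real r)" using e delay_pos by simp
    from LIMSEQ_D[OF t this] obtain M' where M': "\<And>m. m \<ge> M' \<Longrightarrow> cmod (s m - t) < e / (4 * real r)"
      by blast
    \<comment> \<open>A single m, fixed before K because K depends on it, serves both
      approximations.\<close>
    define m where "m = max M M'"
    have st: "cmod (s m - t) * real r \<le> e / 4"
      using M'[of m] delay_pos by (simp add: m_def field_simps)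
    have "0 < e / 4" using e by simp
    from LIMSEQ_D[OF s[of m, unfolded strongly_converges_iff] this]
    obtain K where K: "\<And>n. n \<ge> K \<Longrightarrow> c_mean \<Lambda> r (\<lambda>k. X m k - s m) n < e / 4"
      by (auto simp: c_mean_nonneg)
    have "c_mean \<Lambda> r (\<lambda>k. x k - t) n < e" if "n \<ge> K" for n
    proof -
      have "c_mean \<Lambda> r (\<lambda>k. x k - t) n \<le>
          c_mean \<Lambda> r (\<lambda>k. x k - X m k) n + c_mean \<Lambda> r (\<lambda>k. X m k - t) n"
        using c_mean_add_le[of "\<lambda>k. x k - X m k" "\<lambda>k. X m k - t" n] by simp
      moreover have "c_mean \<Lambda> r (\<lambda>k. X m k - t) n \<le>
          c_mean \<Lambda> r (\<lambda>k. X m k - s m) n + c_mean \<Lambda> r (\<lambda>k. s m - t) n"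
        using c_mean_add_le[of "\<lambda>k. X m k - s m" "\<lambda>k. s m - t" n] by simp
      moreover have "c_mean \<Lambda> r (\<lambda>k. x k - X m k) n \<le> e / 4"
        using M[of m n] by (simp add: m_def c_mean_diff_commute[of x])
      ultimately show ?thesis
        using K[OF that] c_mean_const_le[of "s m - t" n] st e by linarith
    qed
    then show "\<exists>no. \<forall>n\<ge>no. norm (c_mean \<Lambda> r (\<lambda>k. x k - t) n - 0) < e"
      by (auto simp: c_mean_nonneg)
  qed
  then have xV: "x \<in> c_space \<Lambda> r" by (auto simp: c_space_def)
  have "(\<lambda>n. c_norm \<Lambda> r (X n - x)) \<longlonglongrightarrow> 0"
  proof (rule LIMSEQ_I)
    fix e :: real
    assume e: "0 < e"
    \<comment> \<open>The supremum preserves only a weak inequality, so e / 2 secures the strict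
      bound by e.\<close>
    obtain M where M: "\<And>m n. m \<ge> M \<Longrightarrow> c_mean \<Lambda> r (\<lambda>k. X m k - x k) n \<le> e / 2"
      using mean_le[of "e / 2"] e by auto
    have "c_norm \<Lambda> r (X m - x) \<le> e / 2" if "m \<ge> M" for m
      using M[OF that] by (intro c_norm_le) (simp add: fun_diff_def)
    then have "norm (c_norm \<Lambda> r (X m - x) - 0) < e" if "m \<ge> M" for m
      using that e c_norm_nonneg[OF diff_in_c_space[OF X xV], of m] by fastforce
    then show "\<exists>no. \<forall>n\<ge>no. norm (c_norm \<Lambda> r (X n - x) - 0) < e" by blast
  qed
  with xV show ?thesis by blast
qed

section \<open>The Banach space structure\<close>

lemma complex_banach_space_on_c_space:
  "complex_banach_space_on (\<lambda>(c::complex) S k. c * S k) (c_space \<Lambda> r) (c_norm \<Lambda> r)"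
proof -
  interpret vector_space "\<lambda>(c::complex) (S::nat \<Rightarrow> complex) k. c * S k"
    by (rule vector_space_pointwise_scale)
  show ?thesis
  proof
    show "subspace (c_space \<Lambda> r)"
      by (intro subspaceI zero_in_c_space add_in_c_space scale_in_c_space)
  qed (fact c_norm_nonneg c_norm_eq_0_iff c_norm_scale c_norm_triangle c_space_complete)+
qed

end

text \<open>The boundedness conjunct certifies that \<open>c_norm\<close>, a supremum in the reals,
  is the intended finite supremum on the whole space.\<close>

theorem theorem1:
  fixes \<Lambda> :: "nat \<Rightarrow> real" and r :: nat
  assumes "\<And>k. 0 < \<Lambda> k"
    and "mono \<Lambda>"
    and "filterlim \<Lambda> at_top sequentially"
    and "2 \<le> r"
  shows "(\<forall>S\<in>c_space \<Lambda> r. bdd_above (range (c_mean \<Lambda> r S))) \<and>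
    complex_banach_space_on (\<lambda>(c::complex) S k. c * S k) (c_space \<Lambda> r) (c_norm \<Lambda> r)"
proof -
  interpret strong_convergence_weights \<Lambda> r
    using assms by unfold_locales auto
  show ?thesis
    by (intro conjI ballI bdd_above_c_mean complex_banach_space_on_c_space)
qed

end
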